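(* Let $0<\delta<1$, $0<\sigma<1$, $t>0$, $s=\sigma+it$, and define $$S_1(\sigma,t,\delta)=\sum_{m=1}^{[t^{\delta}]}\ \sum_{n=[t^{1-\delta}m]+1}^{[t]+m}\frac{1}{m^{s}n^{\bar s}}.$$ Then, as $t\to\infty$: if $\sigma\neq\frac12$, $$S_1(\sigma,t,\delta)=O\left(t^{\frac12-\sigma}\left(t^{(1-\sigma)\delta}+t^{\sigma\delta}\right)\right)+O\left(\frac{t^{(1-\sigma)\delta}}{t^{\sigma}}\right);$$ and if $\sigma=\frac12$, $$S_1\left(\tfrac12,t,\delta\right)=O\left(t^{\frac{\delta}{2}}\ln t\right)+O\left(\frac{t^{\frac{\delta}{2}}}{t^{\frac12}}\right).$$
   Context: $[A]$ denotes the integer part of $A$, and $\bar s=\sigma-it$ is the complex conjugate of $s$. Sums over empty ranges are zero. The parameters $\sigma,\delta$ are fixed, and the $O$-statements are for real $t\to\infty$ (implied constants may depend on $\sigma,\delta$). *)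

theory Defs
  imports "HOL-Analysis.Analysis" "HOL-Library.Landau_Symbols"
begin

definition S1 :: "real \<Rightarrow> real \<Rightarrow> real \<Rightarrow> complex" where
  "S1 \<sigma> t \<delta> =
     (let s = Complex \<sigma> t in
      \<Sum>m = 1..nat \<lfloor>t powr \<delta>\<rfloor>.
        \<Sum>n = nat \<lfloor>t powr (1 - \<delta>) * real m\<rfloor> + 1..nat \<lfloor>t\<rfloor> + m.
          1 / (of_nat m powr s * of_nat n powr cnj s))"

end

theory Submission
  imports Defs
begin

text \<open>Only the first error term is needed: \<open>S1 = E1\<close> and \<open>E2 = 0\<close>. By van der Corput's second
  derivative test, the sum of \<open>n\<^bsup>it\<^esup>\<close> over any part of a dyadic block \<open>(a, 2a]\<close> with \<open>a \<le> 2t\<close> is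
  \<open>O(t\<^bsup>1/2\<^esup>)\<close>. Partial summation and a geometric series over the blocks bound the inner sum, which
  starts at \<open>a \<sim> t\<^bsup>1-\<delta>\<^esup> m\<close>, by \<open>O(t\<^bsup>1/2\<^esup> (t\<^bsup>1-\<delta>\<^esup> m)\<^bsup>-\<sigma>\<^esup>)\<close>. It remains to sum
  \<open>m\<^bsup>-2\<sigma>\<^esup>\<close> over \<open>m \<le> t\<^bsup>\<delta>\<^esup>\<close>, which is where \<open>\<sigma> = 1/2\<close> produces the logarithm.\<close>

section \<open>Elementary bounds for sine and cotangent\<close>

lemma sin_ge_half:
  fixes x :: real
  assumes "0 \<le> x" "x \<le> 1"
  shows "x / 2 \<le> sin x"
proof -
  have "\<bar>sin x - (\<Sum>m<3. sin_coeff m * x ^ m)\<bar> \<le> inverse (fact 3) * \<bar>x\<bar> ^ 3"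
    by (rule Maclaurin_sin_bound)
  then have "\<bar>sin x - x\<bar> \<le> x ^ 3 / 6"
    using assms by (simp add: eval_nat_numeral sin_coeff_def fact_numeral)
  moreover have "x ^ 3 \<le> x"
    using assms power_decreasing[of 1 3 x] by simp
  ultimately show ?thesis
    using assms by linarith
qed

lemma sin_ge_sin_endpoint:
  fixes y \<eta> :: real
  assumes "0 \<le> \<eta>" "\<eta> \<le> y" "y \<le> pi - \<eta>"
  shows "sin \<eta> \<le> sin y"
proof (cases "y \<le> pi / 2")
  case True
  then show ?thesis
    using assms by (intro sin_monotone_2pi_le) auto
next
  case False
  then have "sin \<eta> \<le> sin (pi - y)"
    using assms by (intro sin_monotone_2pi_le) auto
  then show ?thesis
    by simp
qed

text \<open>The difference \<open>cot x - cot y\<close> equals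
  \<open>sin (y - x) / (sin x * sin y)\<close>, and all three sines have the right sign.\<close>

lemma cot_antimono:
  fixes x y :: real
  assumes "0 < x" "x \<le> y" "y < pi"
  shows "cot y \<le> cot x"
proof -
  have "0 < sin x" "0 < sin y" "0 \<le> sin (y - x)"
    using assms by (auto intro!: sin_gt_zero sin_ge_zero)
  then show ?thesis
    by (simp add: cot_def sin_diff field_simps)
qed

section \<open>The Kusmin-Landau inequality\<close>

text \<open>The point of this form of the reciprocal of \<open>1 - cis (2 * y)\<close> is its
  constant real part 1/2: as \<open>y\<close> varies, only the imaginary part
  \<open>cot y / 2\<close> moves, and it moves monotonically.\<close>

lemma one_minus_cis_double_mult_cot:
  assumes "sin y \<noteq> 0"
  shows "(1 - cis (2 * y)) * (Complex 1 (cot y) / 2) = 1"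
proof -
  have "cis (2 * y) = Complex (1 - 2 * (sin y * sin y)) (2 * sin y * cos y)"
    by (simp add: complex_eq_iff cos_double_sin sin_double power2_eq_square)
  moreover have "Complex 1 (cot y) / 2 = Complex (1/2) (cos y / (2 * sin y))"
    by (simp add: complex_eq_iff cot_def)
  ultimately show ?thesis
    using assms sin_cos_squared_add[of y] by (simp add: complex_eq_iff power2_eq_square)
qed

text \<open>Each term is a difference of consecutive terms times a weight \<open>w n\<close>, so the
  sum can be summed by parts. The weights differ by purely imaginary numbers of one sign, so their
  total variation telescopes to a difference of two cotangents. Here \<open>y n\<close> is half the
  increment of the phase modulo \<open>2 * pi\<close>, with the same \<open>k\<close>
  throughout.\<close>

lemma kusmin_landau:
  fixes G y :: "nat \<Rightarrow> real" and k :: int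
  assumes pq: "p \<le> q"
    and diff: "\<And>n. n \<in> {p..q} \<Longrightarrow> G (Suc n) - G n = 2 * y n + 2 * pi * of_int k"
    and range: "\<And>n. n \<in> {p..q} \<Longrightarrow> \<eta> \<le> y n \<and> y n \<le> pi - \<eta>"
    and anti: "\<And>n. n \<in> {p..<q} \<Longrightarrow> y (Suc n) \<le> y n"
    and \<eta>: "0 < \<eta>" "\<eta> \<le> 1"
  shows "norm (\<Sum>n=p..q. cis (G n)) \<le> 4 / \<eta>"
proof -
  define w where "w n = Complex 1 (cot (y n)) / 2" for n
  have s\<eta>: "\<eta> / 2 \<le> sin \<eta>"
    using \<eta> by (intro sin_ge_half) auto
  have sy: "\<eta> / 2 \<le> sin (y n)" if "n \<in> {p..q}" for n
    using sin_ge_sin_endpoint[of \<eta> "y n"] range[OF that] s\<eta> \<eta> by linarith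
  have cis_eq: "cis (G n) = (cis (G n) - cis (G (Suc n))) * w n" if n: "n \<in> {p..q}" for n
  proof -
    have "cis (G (Suc n)) = cis (G n + 2 * y n + 2 * pi * of_int k)"
      using diff[OF n] by (simp add: algebra_simps)
    also have "\<dots> = cis (G n) * cis (2 * y n)"
      by (simp flip: cis_mult add: cis_multiple_2pi)
    finally have "(cis (G n) - cis (G (Suc n))) * w n = cis (G n) * ((1 - cis (2 * y n)) * w n)"
      by (simp add: algebra_simps)
    also have "(1 - cis (2 * y n)) * w n = 1"
      unfolding w_def using sy[OF n] \<eta> by (intro one_minus_cis_double_mult_cot) auto
    finally show ?thesis
      by simp
  qed
  have cot_mono: "cot (y n) \<le> cot (y (Suc n))" if "n \<in> {p..<q}" for n
    using anti[OF that] range[of n] range[of "Suc n"] that \<eta>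
    by (intro cot_antimono) auto
  have cot_bound: "\<bar>cot (y n)\<bar> \<le> 2 / \<eta>" if n: "n \<in> {p..q}" for n
  proof -
    have "\<bar>cot (y n)\<bar> = \<bar>cos (y n)\<bar> / sin (y n)"
      using sy[OF n] \<eta> by (simp add: cot_def)
    also have "\<dots> \<le> 1 / (\<eta> / 2)"
      using sy[OF n] \<eta> by (intro frac_le) auto
    finally show ?thesis
      by simp
  qed
  have w_bound: "norm (w n) \<le> 1 / \<eta>" if n: "n \<in> {p..q}" for n
  proof -
    have pos: "0 < sin (y n)"
      using sy[OF n] \<eta> by linarith
    have "(norm (w n))\<^sup>2 = (1 + (cot (y n))\<^sup>2) / 4"
      by (simp add: w_def cmod_def norm_divide power_divide)
    also have "\<dots> = (1 / (2 * sin (y n)))\<^sup>2"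
      using pos sin_cos_squared_add[of "y n"]
      by (simp add: cot_def power_divide field_simps power_mult_distrib)
    finally have "norm (w n) = 1 / (2 * sin (y n))"
      using pos by (subst (asm) power2_eq_iff_nonneg) auto
    also have "\<dots> \<le> 1 / \<eta>"
      using sy[OF n] \<eta> by (intro frac_le) auto
    finally show ?thesis .
  qed
  \<comment> \<open>Summation by parts as an induction: once the two boundary terms are taken off,
    what remains is built from the increments of \<open>w\<close>, whose norms telescope.\<close>
  have parts: "r \<le> q \<Longrightarrow>
      norm ((\<Sum>n=p..r. (cis (G n) - cis (G (Suc n))) * w n)
             + cis (G (Suc r)) * w r - cis (G p) * w p)
        \<le> (cot (y r) - cot (y p)) / 2" if "p \<le> r" for r
    using that
  proof (induction r rule: nat_induct_at_least)
    case base
    then show ?case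
      by (simp add: algebra_simps)
  next
    case (Suc r)
    let ?T = "\<lambda>r. (\<Sum>n=p..r. (cis (G n) - cis (G (Suc n))) * w n)
             + cis (G (Suc r)) * w r - cis (G p) * w p"
    have "?T (Suc r) = ?T r + cis (G (Suc r)) * (w (Suc r) - w r)"
      using Suc.hyps by (simp add: algebra_simps)
    then have "norm (?T (Suc r)) \<le> norm (?T r) + norm (cis (G (Suc r)) * (w (Suc r) - w r))"
      by (simp only: norm_triangle_ineq)
    also have "w (Suc r) - w r = Complex 0 ((cot (y (Suc r)) - cot (y r)) / 2)"
      by (simp add: w_def complex_eq_iff diff_divide_distrib)
    also have "norm (cis (G (Suc r)) * Complex 0 ((cot (y (Suc r)) - cot (y r)) / 2))
        = (cot (y (Suc r)) - cot (y r)) / 2"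
      using cot_mono[of r] Suc.hyps Suc.prems by (simp add: norm_mult complex_norm)
    finally show ?case
      using Suc by (simp add: field_simps)
  qed
  have "(\<Sum>n=p..q. cis (G n)) = (\<Sum>n=p..q. (cis (G n) - cis (G (Suc n))) * w n)"
    by (rule sum.cong) (use cis_eq in auto)
  also have "\<dots> = ((\<Sum>n=p..q. (cis (G n) - cis (G (Suc n))) * w n)
             + cis (G (Suc q)) * w q - cis (G p) * w p) - cis (G (Suc q)) * w q + cis (G p) * w p"
    (is "_ = ?A - ?B + ?C")
    by simp
  also have "norm \<dots> \<le> norm ?A + norm ?B + norm ?C"
    by (intro order_trans[OF norm_triangle_ineq] add_right_mono norm_triangle_ineq4)
  also have "\<dots> \<le> (cot (y q) - cot (y p)) / 2 + 1 / \<eta> + 1 / \<eta>"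
    using parts[of q] w_bound[of p] w_bound[of q] pq by (intro add_mono) (auto simp: norm_mult)
  \<comment> \<open>The total variation and the two boundary terms contribute
    \<open>2 / \<eta>\<close> each.\<close>
  also have "\<dots> \<le> (2 / \<eta> + 2 / \<eta>) / 2 + 1 / \<eta> + 1 / \<eta>"
  proof -
    have "cot (y q) \<le> 2 / \<eta>" "- cot (y p) \<le> 2 / \<eta>"
      using cot_bound[of p] cot_bound[of q] pq by (auto simp: abs_le_iff)
    then have "cot (y q) + - cot (y p) \<le> 2 / \<eta> + 2 / \<eta>"
      by (rule add_mono)
    then show ?thesis
      by (intro add_right_mono divide_right_mono) auto
  qed
  also have "\<dots> = 4 / \<eta>"
    by (simp add: field_simps)
  finally show ?thesis .
qed

section \<open>The second derivative test of van der Corput\<close>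

text \<open>Kusmin-Landau needs consecutive indices. This turns a set of indices selected by a
  condition on a monotone sequence into an interval.\<close>

lemma finite_convex_nat_set_eq_interval:
  fixes S :: "nat set"
  assumes "finite S" "S \<noteq> {}"
    and "\<And>a b c. a \<in> S \<Longrightarrow> c \<in> S \<Longrightarrow> a \<le> b \<Longrightarrow> b \<le> c \<Longrightarrow> b \<in> S"
  shows "S = {Min S..Max S}"
proof
  show "S \<subseteq> {Min S..Max S}"
    using assms(1) by auto
  show "{Min S..Max S} \<subseteq> S"
    using assms(3)[OF Min_in[OF assms(1,2)] Max_in[OF assms(1,2)]] by auto
qed

lemma gap_le_of_step:
  fixes d :: "nat \<Rightarrow> real"
  assumes step: "\<And>n. n \<in> {p..<q} \<Longrightarrow> \<mu> \<le> d n - d (Suc n)"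
    and "p \<le> a" "a \<le> b" "b \<le> q"
  shows "real (b - a) * \<mu> \<le> d a - d b"
  using assms(3,4)
proof (induction b rule: nat_induct_at_least)
  case (Suc b)
  then show ?case
    using step[of b] \<open>p \<le> a\<close> by (simp add: Suc_diff_le algebra_simps)
qed simp

text \<open>Every step lowers \<open>d\<close> by at least \<open>\<mu>\<close>, so the smallest and
  largest elements of \<open>S\<close> are at most \<open>L / \<mu>\<close> apart; the
  \<open>+ 1\<close> counts both ends.\<close>

lemma card_le_of_separated:
  fixes d :: "nat \<Rightarrow> real"
  assumes step: "\<And>n. n \<in> {p..<q} \<Longrightarrow> \<mu> \<le> d n - d (Suc n)" and "0 < \<mu>"
    and S: "S \<subseteq> {p..q}" and range: "\<And>n. n \<in> S \<Longrightarrow> u \<le> d n \<and> d n \<le> u + L" and "0 \<le> L"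
  shows "real (card S) \<le> L / \<mu> + 1"
proof (cases "S = {}")
  case False
  have fin: "finite S"
    using S finite_subset by blast
  define a b where "a = Min S" and "b = Max S"
  have ab: "a \<in> S" "b \<in> S" "a \<le> b"
    using fin False by (auto simp: a_def b_def)
  have "S \<subseteq> {a..b}"
    using fin by (auto simp: a_def b_def)
  then have "card S \<le> Suc b - a"
    using card_mono[of "{a..b}" S] by simp
  then have "real (card S) \<le> real (b - a) + 1"
    using ab by linarith
  moreover have "real (b - a) * \<mu> \<le> d a - d b"
    using ab S by (intro gap_le_of_step[of p q \<mu> d, OF step]) auto
  then have "real (b - a) * \<mu> \<le> L"
    using range[of a] range[of b] ab by linarith
  then have "real (b - a) \<le> L / \<mu>"
    using \<open>0 < \<mu>\<close> by (simp add: field_simps)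
  ultimately show ?thesis
    by linarith
qed (use assms in auto)

lemma norm_sum_cis_le_card: "norm (\<Sum>n\<in>S. cis (G n)) \<le> real (card S)"
  using sum_norm_le[of S "\<lambda>n. cis (G n)" "\<lambda>_. 1"] by simp

text \<open>Within one period of the increments, Kusmin-Landau handles the increments at distance at
  least \<open>2 * \<eta>\<close> from \<open>2 * pi * \<int>\<close>; the remaining ones are few because they are \<open>\<mu>\<close>-separated.\<close>

lemma second_derivative_test:
  fixes G :: "nat \<Rightarrow> real"
  defines "d \<equiv> \<lambda>n. G (Suc n) - G n"
  assumes step: "\<And>n. n \<in> {p..<q} \<Longrightarrow> \<mu> \<le> d n - d (Suc n)" and \<mu>: "0 < \<mu>"
    and range: "\<And>n. n \<in> {p..q} \<Longrightarrow> 0 \<le> d n \<and> d n \<le> D" and "0 \<le> D"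
    and \<eta>: "0 < \<eta>" "\<eta> \<le> 1"
  shows "norm (\<Sum>n=p..q. cis (G n)) \<le> (D + 1) * (2 * (2 * \<eta> / \<mu> + 1) + 4 / \<eta>)"
proof -
  \<comment> \<open>\<open>\<kappa> n\<close> is the period that contains the increment
    \<open>d n\<close>, and \<open>y n\<close> is half of the residue, so that it lies in the
    interval from 0 to \<open>pi\<close> required by the cotangent.\<close>
  define \<kappa> where "\<kappa> n = \<lfloor>d n / (2 * pi)\<rfloor>" for n
  define y where "y n = (d n - 2 * pi * of_int (\<kappa> n)) / 2" for n
  define B where "B = 2 * (2 * \<eta> / \<mu> + 1) + 4 / \<eta>"
  have "0 \<le> B"
    using \<mu> \<eta> by (simp add: B_def)
  have y: "0 \<le> y n" "y n < pi" for n
  proof -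
    have "of_int (\<kappa> n) \<le> d n / (2 * pi)" "d n / (2 * pi) < of_int (\<kappa> n) + 1"
      by (auto simp: \<kappa>_def)
    then show "0 \<le> y n" "y n < pi"
      by (auto simp: y_def field_simps)
  qed
  have dec: "d b \<le> d a" if "p \<le> a" "a \<le> b" "b \<le> q" for a b
  proof -
    have "real (b - a) * \<mu> \<le> d a - d b"
      by (rule gap_le_of_step[of p q \<mu> d, OF step]) (use that in auto)
    moreover have "0 \<le> real (b - a) * \<mu>"
      using \<mu> by simp
    ultimately show ?thesis
      by linarith
  qed
  have fiber: "norm (\<Sum>n | n \<in> {p..q} \<and> \<kappa> n = k. cis (G n)) \<le> B" for k
  proof -
    define F where "F = {n \<in> {p..q}. \<kappa> n = k}"
    \<comment> \<open>\<open>F1\<close> and \<open>F3\<close> collect the increments within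
      \<open>2 * \<eta>\<close> of the lower and upper end of the period and are bounded by
      counting; \<open>F2\<close> goes to Kusmin-Landau. The condition
      \<open>\<eta> \<le> y n\<close> in \<open>F3\<close> makes the three sets disjoint without
      comparing \<open>\<eta>\<close> with \<open>pi - \<eta>\<close>.\<close>
    define F1 where "F1 = {n \<in> F. y n < \<eta>}"
    define F2 where "F2 = {n \<in> F. \<eta> \<le> y n \<and> y n \<le> pi - \<eta>}"
    define F3 where "F3 = {n \<in> F. \<eta> \<le> y n \<and> pi - \<eta> < y n}"
    have d_eq: "d n = 2 * y n + 2 * pi * of_int k" if "n \<in> F" for n
      using that by (simp add: F_def y_def field_simps)
    have fin: "finite F"
      by (simp add: F_def)
    have "F = F1 \<union> (F2 \<union> F3)"
      by (auto simp: F1_def F2_def F3_def)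
    then have "(\<Sum>n\<in>F. cis (G n)) = (\<Sum>n\<in>F1 \<union> (F2 \<union> F3). cis (G n))"
      by simp
    also have "\<dots> = (\<Sum>n\<in>F1. cis (G n)) + (\<Sum>n\<in>F2 \<union> F3. cis (G n))"
      by (rule sum.union_disjoint) (use fin in \<open>auto simp: F1_def F2_def F3_def\<close>)
    also have "(\<Sum>n\<in>F2 \<union> F3. cis (G n)) = (\<Sum>n\<in>F2. cis (G n)) + (\<Sum>n\<in>F3. cis (G n))"
      by (rule sum.union_disjoint) (use fin in \<open>auto simp: F2_def F3_def\<close>)
    finally have split: "(\<Sum>n\<in>F. cis (G n)) =
        (\<Sum>n\<in>F1. cis (G n)) + ((\<Sum>n\<in>F2. cis (G n)) + (\<Sum>n\<in>F3. cis (G n)))" .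
    have "real (card F1) \<le> 2 * \<eta> / \<mu> + 1"
    proof (rule card_le_of_separated[of p q \<mu> d, OF step \<mu>])
      show "2 * pi * of_int k \<le> d n \<and> d n \<le> 2 * pi * of_int k + 2 * \<eta>" if "n \<in> F1" for n
        using that d_eq[of n] y[of n] by (auto simp: F1_def)
    qed (use \<eta> in \<open>auto simp: F1_def F_def\<close>)
    then have b1: "norm (\<Sum>n\<in>F1. cis (G n)) \<le> 2 * \<eta> / \<mu> + 1"
      using norm_sum_cis_le_card order_trans by blast
    have "real (card F3) \<le> 2 * \<eta> / \<mu> + 1"
    proof (rule card_le_of_separated[of p q \<mu> d, OF step \<mu>])
      show "2 * pi * of_int k + 2 * pi - 2 * \<eta> \<le> d n
          \<and> d n \<le> 2 * pi * of_int k + 2 * pi - 2 * \<eta> + 2 * \<eta>" if "n \<in> F3" for n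
        using that d_eq[of n] y[of n] by (auto simp: F3_def)
    qed (use \<eta> in \<open>auto simp: F3_def F_def\<close>)
    then have b3: "norm (\<Sum>n\<in>F3. cis (G n)) \<le> 2 * \<eta> / \<mu> + 1"
      using norm_sum_cis_le_card order_trans by blast
    have b2: "norm (\<Sum>n\<in>F2. cis (G n)) \<le> 4 / \<eta>"
    proof (cases "F2 = {}")
      case False
      \<comment> \<open>The window for \<open>d n\<close> lies strictly inside one period, so it
        already forces \<open>\<kappa> n = k\<close>. Being a condition on the monotone
        \<open>d\<close> alone, it cuts out an interval of indices.\<close>
      have F2: "n \<in> F2 \<longleftrightarrow> n \<in> {p..q} \<and>
          2 * pi * of_int k + 2 * \<eta> \<le> d n \<and> d n \<le> 2 * pi * of_int k + 2 * (pi - \<eta>)" for n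
      proof
        assume "n \<in> F2"
        then show "n \<in> {p..q} \<and> 2 * pi * of_int k + 2 * \<eta> \<le> d n
            \<and> d n \<le> 2 * pi * of_int k + 2 * (pi - \<eta>)"
          using d_eq[of n] by (auto simp: F2_def F_def)
      next
        assume *: "n \<in> {p..q} \<and> 2 * pi * of_int k + 2 * \<eta> \<le> d n
            \<and> d n \<le> 2 * pi * of_int k + 2 * (pi - \<eta>)"
        then have "of_int k \<le> d n / (2 * pi)" "d n / (2 * pi) < of_int k + 1"
          using \<eta> by (auto simp: field_simps)
        then have "\<kappa> n = k"
          unfolding \<kappa>_def by (intro floor_unique) auto
        then show "n \<in> F2"
          using * d_eq[of n] by (auto simp: F2_def F_def)
      qed
      have convex: "b \<in> F2" if "a \<in> F2" "c \<in> F2" "a \<le> b" "b \<le> c" for a b c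
        using that dec[of a b] dec[of b c] unfolding F2 by auto
      have "finite F2"
        using fin by (simp add: F2_def)
      then have eq: "F2 = {Min F2..Max F2}" and le: "Min F2 \<le> Max F2"
        using finite_convex_nat_set_eq_interval[OF _ False convex] False by auto
      show ?thesis
      proof (subst eq, rule kusmin_landau[OF le])
        fix n assume "n \<in> {Min F2..Max F2}"
        then have "n \<in> F2"
          using eq by blast
        then show "G (Suc n) - G n = 2 * y n + 2 * pi * of_int k" "\<eta> \<le> y n \<and> y n \<le> pi - \<eta>"
          using d_eq[of n] by (auto simp: F2_def d_def)
      next
        fix n assume "n \<in> {Min F2..<Max F2}"
        then have "n \<in> {Min F2..Max F2}" "Suc n \<in> {Min F2..Max F2}"
          by auto
        then have "n \<in> F2" "Suc n \<in> F2"
          using eq by blast+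
        then show "y (Suc n) \<le> y n"
          using dec[of n "Suc n"] d_eq[of n] d_eq[of "Suc n"] by (auto simp: F2_def F_def)
      qed (use \<eta> in auto)
    qed (use \<eta> in auto)
    have "norm (\<Sum>n\<in>F. cis (G n)) \<le> norm (\<Sum>n\<in>F1. cis (G n)) +
        (norm (\<Sum>n\<in>F2. cis (G n)) + norm (\<Sum>n\<in>F3. cis (G n)))"
      unfolding split by (intro order_trans[OF norm_triangle_ineq] add_left_mono norm_triangle_ineq)
    also have "\<dots> \<le> B"
      using b1 b2 b3 by (simp add: B_def)
    finally show ?thesis
      by (simp add: F_def)
  qed
  \<comment> \<open>The number of periods is estimated crudely: the divisor \<open>2 * pi\<close> is
    replaced by 1.\<close>
  have img: "\<kappa> ` {p..q} \<subseteq> {0..\<lfloor>D\<rfloor>}"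
  proof
    fix k assume "k \<in> \<kappa> ` {p..q}"
    then obtain n where n: "n \<in> {p..q}" "k = \<kappa> n"
      by blast
    have "d n / (2 * pi) \<le> d n / 1"
      using range[OF n(1)] pi_gt3 by (intro divide_left_mono) auto
    then have "d n / (2 * pi) \<le> D"
      using range[OF n(1)] by simp
    then show "k \<in> {0..\<lfloor>D\<rfloor>}"
      using range[OF n(1)] by (auto simp: n \<kappa>_def intro: floor_mono)
  qed
  have "(\<Sum>n=p..q. cis (G n)) = (\<Sum>k\<in>{0..\<lfloor>D\<rfloor>}. \<Sum>n | n \<in> {p..q} \<and> \<kappa> n = k. cis (G n))"
    by (rule sum.group[symmetric]) (use img in auto)
  also have "norm \<dots> \<le> (\<Sum>k\<in>{0..\<lfloor>D\<rfloor>}. B)"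
    by (rule sum_norm_le) (rule fiber)
  also have "\<dots> = real_of_int (\<lfloor>D\<rfloor> + 1) * B"
    using \<open>0 \<le> D\<close> by simp
  also have "\<dots> \<le> (D + 1) * B"
    using \<open>0 \<le> B\<close> by (intro mult_right_mono) auto
  finally show ?thesis
    by (simp add: B_def)
qed

section \<open>Sums of n^(it) over a dyadic block\<close>

text \<open>The second difference is \<open>- ln x\<close> for
  \<open>x = n * (n + 2) / (n + 1)^2 = 1 - 1 / (n + 1)^2\<close>, and
  \<open>ln x \<le> x - 1\<close>.\<close>

lemma ln_second_difference_ge:
  fixes n :: nat
  assumes "0 < n"
  shows "1 / real (Suc n) ^ 2 \<le> (ln (Suc n) - ln n) - (ln (Suc (Suc n)) - ln (Suc n))"
proof -
  define x where "x = real n * (real n + 2) / (real n + 1)\<^sup>2"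
  have pos: "0 < x"
    using assms by (simp add: x_def)
  have "ln x = ln n + ln (Suc (Suc n)) - 2 * ln (Suc n)"
    using assms by (simp add: x_def ln_div ln_mult ln_realpow add.commute)
  moreover have "ln x \<le> x - 1"
    by (rule ln_le_minus_one[OF pos])
  moreover have "x - 1 = - (1 / real (Suc n) ^ 2)"
    by (simp add: x_def divide_simps power2_eq_square) (simp add: algebra_simps)
  ultimately show ?thesis
    by simp
qed

text \<open>For \<open>a \<le> sqrt t\<close> the number of terms suffices. Otherwise the phase has
  increments at most \<open>t / a\<close> and second differences of order \<open>t / a^2\<close>,
  and the second derivative test gives a bound of order
  \<open>(t / a) * (a / sqrt t) = sqrt t\<close>.\<close>

lemma norm_sum_cis_ln_block:
  fixes a b :: nat and t :: real
  assumes t: "1 \<le> t" and a: "0 < a" "real a \<le> 2 * t" and b: "b \<le> 2 * a"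
  shows "norm (\<Sum>n=Suc a..b. cis (t * ln n)) \<le> 100 * sqrt t"
proof (cases "real a \<le> sqrt t")
  case True
  have "norm (\<Sum>n=Suc a..b. cis (t * ln n)) \<le> real (card {Suc a..b})"
    by (rule norm_sum_cis_le_card)
  also have "\<dots> \<le> real a"
    using b by simp
  also have "\<dots> \<le> 100 * sqrt t"
    using True t by simp
  finally show ?thesis .
next
  case False
  define r where "r = sqrt t"
  have r: "0 < r" "r * r = t"
    using t by (auto simp: r_def)
  \<comment> \<open>Taking \<open>\<eta>\<close> as the square root of \<open>\<mu>\<close> balances
    the counting term \<open>4 * \<eta> / \<mu>\<close> against the Kusmin-Landau term
    \<open>4 / \<eta>\<close>. It is at most 1 because \<open>sqrt t < a\<close> in this
    case.\<close>
  define \<eta> where "\<eta> = r / (3 * a)"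
  define \<mu> where "\<mu> = t / (3 * a)\<^sup>2"
  have \<eta>: "0 < \<eta>" "\<eta> \<le> 1"
    using r a False by (auto simp: \<eta>_def r_def[symmetric])
  have \<mu>: "\<mu> = \<eta> * \<eta>"
    using r by (simp add: \<mu>_def \<eta>_def power2_eq_square)
  have "norm (\<Sum>n=Suc a..b. cis (t * ln n)) \<le> (t / a + 1) * (2 * (2 * \<eta> / \<mu> + 1) + 4 / \<eta>)"
  proof (rule second_derivative_test)
    fix n assume n: "n \<in> {Suc a..<b}"
    have "(real (Suc n))\<^sup>2 \<le> (3 * real a)\<^sup>2"
      using n b by (intro power_mono) auto
    then have "\<mu> \<le> t / (real (Suc n))\<^sup>2"
      unfolding \<mu>_def using t by (intro frac_le) auto
    also have "\<dots> \<le> t * ((ln (Suc n) - ln n) - (ln (Suc (Suc n)) - ln (Suc n)))"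
      using mult_left_mono[OF ln_second_difference_ge[of n], of t] n t by simp
    finally show "\<mu> \<le> t * ln (Suc n) - t * ln n - (t * ln (Suc (Suc n)) - t * ln (Suc n))"
      by (simp add: algebra_simps)
  next
    fix n assume n: "n \<in> {Suc a..b}"
    have pos: "0 < real n"
      using n by simp
    have "ln (Suc n) - ln n = ln (Suc n / n)"
      using pos by (simp add: ln_div)
    also have "real (Suc n) / n = 1 + 1 / n"
      using pos by (simp add: field_simps)
    also have "ln (1 + 1 / n) \<le> 1 / n"
      by (rule ln_add_one_self_le_self) simp
    also have "\<dots> \<le> 1 / a"
      using n a by (intro divide_left_mono) auto
    finally have "t * (ln (Suc n) - ln n) \<le> t * (1 / a)"
      using t by (intro mult_left_mono) auto
    moreover have "0 \<le> t * (ln (Suc n) - ln n)"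
      using t pos by simp
    ultimately show "0 \<le> t * ln (Suc n) - t * ln n \<and> t * ln (Suc n) - t * ln n \<le> t / a"
      by (simp add: algebra_simps)
  qed (use \<eta> \<mu> t in auto)
  also have "\<dots> = (t / a + 1) * (8 / \<eta> + 2)"
    using \<eta> by (simp add: \<mu> field_simps)
  \<comment> \<open>The hypothesis \<open>a \<le> 2 * t\<close> gives
    \<open>1 \<le> 2 * (t / a)\<close>, and \<open>\<eta> \<le> 1\<close> gives
    \<open>2 \<le> 2 / \<eta>\<close>.\<close>
  also have "\<dots> \<le> (3 * (t / a)) * (8 / \<eta> + 2 / \<eta>)"
    using a \<eta> t by (intro mult_mono add_mono) (auto simp: field_simps)
  also have "\<dots> = 90 * r"
    using a r(1) by (simp add: \<eta>_def field_simps flip: r(2))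
  also have "\<dots> \<le> 100 * sqrt t"
    using r by (simp add: r_def)
  finally show ?thesis .
qed

section \<open>Partial summation and dyadic decomposition\<close>

text \<open>Abel summation: replacing all weights by the last one costs the total drop
  \<open>w a - w b\<close> times \<open>B\<close>, and the last weight itself costs
  \<open>w b * B\<close>. Measuring the drop from index \<open>a\<close>, one before the first
  summand, makes the induction start at an empty sum.\<close>

lemma norm_sum_antimono_weights_le:
  fixes w :: "nat \<Rightarrow> real" and z :: "nat \<Rightarrow> complex"
  assumes w: "\<And>n. n \<in> {Suc a..b} \<Longrightarrow> 0 \<le> w n \<and> w n \<le> w (n - 1)" and "0 \<le> w a"
    and z: "\<And>c. c \<le> b \<Longrightarrow> norm (\<Sum>n=Suc a..c. z n) \<le> B" and "0 \<le> B"
  shows "norm (\<Sum>n=Suc a..b. of_real (w n) * z n) \<le> w a * B"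
proof (cases "a \<le> b")
  case True
  have *: "norm ((\<Sum>n=Suc a..c. of_real (w n) * z n) - of_real (w c) * (\<Sum>n=Suc a..c. z n))
      \<le> (w a - w c) * B" if "a \<le> c" "c \<le> b" for c
    using that
  proof (induction c rule: nat_induct_at_least)
    case (Suc c)
    let ?D = "\<lambda>c. (\<Sum>n=Suc a..c. of_real (w n) * z n) - of_real (w c) * (\<Sum>n=Suc a..c. z n)"
    have "?D (Suc c) = ?D c + of_real (w c - w (Suc c)) * (\<Sum>n=Suc a..c. z n)"
      using Suc.hyps by (simp add: algebra_simps)
    then have "norm (?D (Suc c)) \<le> norm (?D c) + norm (of_real (w c - w (Suc c)) * (\<Sum>n=Suc a..c. z n))"
      by (simp only: norm_triangle_ineq)
    also have "\<dots> \<le> (w a - w c) * B + (w c - w (Suc c)) * B"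
      using Suc w[of "Suc c"] z[of c]
      by (intro add_mono) (auto simp: norm_mult intro!: mult_mono simp del: of_real_diff)
    finally show ?case
      by (simp add: algebra_simps)
  qed simp
  have wb: "0 \<le> w b"
    using w[of b] \<open>0 \<le> w a\<close> True by (cases "a = b") auto
  have "norm (\<Sum>n=Suc a..b. of_real (w n) * z n) \<le>
      norm (of_real (w b) * (\<Sum>n=Suc a..b. z n))
      + norm ((\<Sum>n=Suc a..b. of_real (w n) * z n) - of_real (w b) * (\<Sum>n=Suc a..b. z n))"
    by (rule norm_triangle_sub)
  also have "\<dots> \<le> w b * B + (w a - w b) * B"
    using *[of b] True z[of b] wb by (intro add_mono) (auto simp: norm_mult intro!: mult_left_mono)
  finally show ?thesis
    by (simp add: algebra_simps)
qed (use assms in auto)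

lemma norm_dirichlet_block:
  fixes a b :: nat and t \<sigma> :: real
  assumes "1 \<le> t" "0 < a" "real a \<le> 2 * t" "b \<le> 2 * a" "0 \<le> \<sigma>"
  shows "norm (\<Sum>n=Suc a..b. of_real (real n powr - \<sigma>) * cis (t * ln n))
    \<le> real a powr - \<sigma> * (100 * sqrt t)"
proof (rule norm_sum_antimono_weights_le)
  show "norm (\<Sum>n=Suc a..c. cis (t * ln n)) \<le> 100 * sqrt t" if "c \<le> b" for c
    using assms that by (intro norm_sum_cis_ln_block) auto
  show "0 \<le> real n powr - \<sigma> \<and> real n powr - \<sigma> \<le> real (n - 1) powr - \<sigma>" if "n \<in> {Suc a..b}" for n
    using assms that by (auto intro!: powr_mono2')
qed (use assms in auto)

text \<open>Strong induction on the length peels off the block from \<open>a\<close> to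
  \<open>2 * a\<close>. The tail satisfies the same bound with \<open>2 * a\<close> for
  \<open>a\<close>, hence shrunk by the factor \<open>2 powr - \<sigma> < 1\<close>: a geometric
  series in disguise.\<close>

lemma norm_dirichlet_sum_le:
  fixes a b :: nat and t \<sigma> :: real
  assumes "1 \<le> t" "0 < a" "real b \<le> 2 * t" "0 < \<sigma>"
  shows "norm (\<Sum>n=Suc a..b. of_real (real n powr - \<sigma>) * cis (t * ln n))
    \<le> 100 / (1 - 2 powr - \<sigma>) * sqrt t * real a powr - \<sigma>"
  using \<open>0 < a\<close>
proof (induction "b - a" arbitrary: a rule: less_induct)
  case less
  let ?f = "\<lambda>n. of_real (real n powr - \<sigma>) * cis (t * ln n) :: complex"
  define q where "q = 2 powr - \<sigma>"
  have q: "0 < q" "q < 1"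
    using \<open>0 < \<sigma>\<close> by (auto simp: q_def powr_less_one)
  define K where "K = 100 / (1 - q)"
  \<comment> \<open>\<open>K\<close> is the fixed point of the recursion: 100 for the first block
    plus \<open>K * q\<close> for the tail.\<close>
  have K: "100 + K * q = K" "100 \<le> K"
    using q by (auto simp: K_def field_simps)
  consider "b \<le> a" | "a < b" "b \<le> 2 * a" | "2 * a < b"
    by linarith
  then have "norm (\<Sum>n=Suc a..b. ?f n) \<le> K * sqrt t * real a powr - \<sigma>"
  proof cases
    case 1
    then show ?thesis
      using K \<open>1 \<le> t\<close> by simp
  next
    case 2
    then have "norm (\<Sum>n=Suc a..b. ?f n) \<le> real a powr - \<sigma> * (100 * sqrt t)"
      using assms less.prems by (intro norm_dirichlet_block) auto
    also have "\<dots> \<le> real a powr - \<sigma> * (K * sqrt t)"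
      using K \<open>1 \<le> t\<close> by (intro mult_left_mono mult_right_mono) auto
    finally show ?thesis
      by (simp add: algebra_simps)
  next
    case 3
    have "(\<Sum>n=Suc a..b. ?f n) = (\<Sum>n=Suc a..2*a. ?f n) + (\<Sum>n=Suc (2*a)..b. ?f n)"
      using 3 sum.ub_add_nat[of "Suc a" "2*a" ?f "b - 2*a"] less.prems by simp
    then have "norm (\<Sum>n=Suc a..b. ?f n)
        \<le> norm (\<Sum>n=Suc a..2*a. ?f n) + norm (\<Sum>n=Suc (2*a)..b. ?f n)"
      by (simp only: norm_triangle_ineq)
    also have "\<dots> \<le> real a powr - \<sigma> * (100 * sqrt t)
        + 100 / (1 - 2 powr - \<sigma>) * sqrt t * real (2 * a) powr - \<sigma>"
      using assms less.prems 3 by (intro add_mono norm_dirichlet_block less.hyps) auto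
    also have "\<dots> = real a powr - \<sigma> * sqrt t * (100 + K * q)"
      by (simp add: powr_mult K_def q_def algebra_simps)
    finally show ?thesis
      by (simp only: K mult_ac)
  qed
  then show ?case
    by (simp add: K_def q_def)
qed

section \<open>Reduction of the double sum to a sum over m\<close>

text \<open>Comparison with the integral: by the mean value theorem each term is at most the
  increment of \<open>z powr (1 - \<alpha>) / (1 - \<alpha>)\<close>. The step from 0 to 1 is
  checked directly, since the derivative rule needs a positive argument.\<close>

lemma sum_powr_minus_le:
  fixes \<alpha> :: real
  assumes "0 \<le> \<alpha>" "\<alpha> < 1"
  shows "(\<Sum>m=1..M. real m powr - \<alpha>) \<le> real M powr (1 - \<alpha>) / (1 - \<alpha>)"
proof (induction M)
  case (Suc M)
  have "(1 - \<alpha>) * real (Suc M) powr - \<alpha> \<le> real (Suc M) powr (1 - \<alpha>) - real M powr (1 - \<alpha>)"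
  proof (cases "M = 0")
    case False
    have "\<exists>z. real M < z \<and> z < real (Suc M) \<and>
        real (Suc M) powr (1 - \<alpha>) - real M powr (1 - \<alpha>)
          = (real (Suc M) - real M) * ((1 - \<alpha>) * z powr (1 - \<alpha> - 1))"
    proof (rule MVT2)
      show "((\<lambda>z. z powr (1 - \<alpha>)) has_real_derivative (1 - \<alpha>) * x powr (1 - \<alpha> - 1)) (at x)"
        if "real M \<le> x" for x
        using that False by (intro has_real_derivative_powr) auto
    qed simp
    then obtain z where z: "real M < z" "z < real (Suc M)"
      "real (Suc M) powr (1 - \<alpha>) - real M powr (1 - \<alpha>) = (1 - \<alpha>) * z powr - \<alpha>"
      by auto
    have "real (Suc M) powr - \<alpha> \<le> z powr - \<alpha>"
      using z assms by (intro powr_mono2') auto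
    then show ?thesis
      using z(3) assms by (simp add: mult_left_mono)
  qed (use assms in auto)
  then have "real (Suc M) powr - \<alpha> \<le> (real (Suc M) powr (1 - \<alpha>) - real M powr (1 - \<alpha>)) / (1 - \<alpha>)"
    using assms by (simp add: field_simps)
  then show ?case
    using Suc by (simp add: diff_divide_distrib)
qed simp

text \<open>Conjugating \<open>s\<close> gives the two factors opposite phases. The factor in
  \<open>m\<close> then leaves the inner sum, and the factor in \<open>n\<close> has the phase
  \<open>t * ln n\<close> treated above.\<close>

lemma inverse_nat_powr_product:
  assumes "0 < m" "0 < n"
  shows "1 / (of_nat m powr Complex \<sigma> t * of_nat n powr cnj (Complex \<sigma> t))
    = of_real (real m powr - \<sigma>) * cis (- (t * ln m)) * (of_real (real n powr - \<sigma>) * cis (t * ln n))"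
proof -
  have *: "of_nat k powr Complex \<sigma> u = of_real (real k powr \<sigma>) * cis (u * ln k)" if "0 < k" for k u
  proof -
    have "of_nat k powr Complex \<sigma> u = exp (Complex \<sigma> u * of_real (ln k))"
      using that by (simp add: powr_def Ln_of_nat)
    also have "\<dots> = of_real (exp (\<sigma> * ln k)) * cis (u * ln k)"
      by (subst exp_eq_polar) simp
    finally show ?thesis
      using that by (simp add: powr_def)
  qed
  show ?thesis
    using assms by (simp add: * complex_cnj powr_minus field_simps flip: cis_inverse)
qed

text \<open>One factor \<open>m powr - \<sigma>\<close> is the modulus of the outer factor; the
  second comes from the inner sum, which starts near \<open>t powr (1 - \<delta>) * m\<close>. The
  power of \<open>t\<close> is \<open>1/2 - \<sigma> * (1 - \<delta>)\<close>.\<close>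

lemma norm_S1_le:
  fixes \<sigma> \<delta> t :: real
  assumes "0 < \<delta>" "\<delta> < 1" "0 < \<sigma>" "\<sigma> < 1" and t: "1 \<le> t"
  shows "norm (S1 \<sigma> t \<delta>) \<le> 100 * 2 powr \<sigma> / (1 - 2 powr - \<sigma>) * t powr (1/2 - \<sigma> + \<sigma> * \<delta>)
    * (\<Sum>m=1..nat \<lfloor>t powr \<delta>\<rfloor>. real m powr - (2 * \<sigma>))"
proof -
  define M where "M = nat \<lfloor>t powr \<delta>\<rfloor>"
  define A where "A m = nat \<lfloor>t powr (1 - \<delta>) * real m\<rfloor>" for m :: nat
  define K where "K = 100 / (1 - 2 powr - \<sigma>)"
  have K: "0 \<le> K"
    using assms powr_less_one[of 2 "-\<sigma>"] by (simp add: K_def)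
  let ?f = "\<lambda>n. of_real (real n powr - \<sigma>) * cis (t * ln n) :: complex"
  have S1_eq: "S1 \<sigma> t \<delta> = (\<Sum>m=1..M. of_real (real m powr - \<sigma>) * cis (- (t * ln m)) *
      (\<Sum>n=Suc (A m)..nat \<lfloor>t\<rfloor> + m. ?f n))"
    unfolding S1_def Let_def M_def[symmetric] A_def[symmetric] sum_distrib_left
    by (intro sum.cong) (auto simp: inverse_nat_powr_product)
  have summand: "norm (of_real (real m powr - \<sigma>) * cis (- (t * ln m)) *
      (\<Sum>n=Suc (A m)..nat \<lfloor>t\<rfloor> + m. ?f n))
      \<le> K * 2 powr \<sigma> * t powr (1/2 - \<sigma> + \<sigma> * \<delta>) * real m powr - (2 * \<sigma>)" if m: "m \<in> {1..M}" for m
  proof -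
    define x where "x = t powr (1 - \<delta>) * real m"
    have x: "1 \<le> x"
      using m t assms ge_one_powr_ge_zero[of t "1 - \<delta>"] mult_mono[of 1 "t powr (1 - \<delta>)" 1 "real m"]
      by (simp add: x_def)
    have "1 \<le> \<lfloor>x\<rfloor>"
      using x by simp
    \<comment> \<open>For \<open>x \<ge> 1\<close> the floor loses at most a factor 2, the source of
      \<open>2 powr \<sigma>\<close> in the constant.\<close>
    then have A: "x / 2 \<le> real (A m)" "0 < A m"
      unfolding A_def x_def[symmetric] by linarith+
    \<comment> \<open>Since \<open>\<delta> < 1\<close>, the shift by \<open>m\<close> keeps the
      upper end of the inner sum below \<open>2 * t\<close>, the range in which the block estimates
      hold.\<close>
    have "real m \<le> t powr \<delta>"
      using m by (simp add: M_def) linarith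
    also have "\<dots> \<le> t"
      using powr_mono[of \<delta> 1 t] t assms by simp
    finally have "real (nat \<lfloor>t\<rfloor> + m) \<le> 2 * t"
      using t by simp linarith
    then have "norm (\<Sum>n=Suc (A m)..nat \<lfloor>t\<rfloor> + m. ?f n) \<le> K * sqrt t * real (A m) powr - \<sigma>"
      unfolding K_def using t A assms by (intro norm_dirichlet_sum_le) auto
    also have "real (A m) powr - \<sigma> \<le> (x / 2) powr - \<sigma>"
      using A x assms by (intro powr_mono2') auto
    also have "(x / 2) powr - \<sigma> = 2 powr \<sigma> * t powr (- \<sigma> + \<sigma> * \<delta>) * real m powr - \<sigma>"
    proof -
      have "t powr (- \<sigma> + \<sigma> * \<delta>) = (t powr (1 - \<delta>)) powr - \<sigma>"
        by (simp add: powr_powr algebra_simps)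
      then show ?thesis
        by (simp add: x_def powr_divide powr_mult powr_minus_divide)
    qed
    finally have "norm (\<Sum>n=Suc (A m)..nat \<lfloor>t\<rfloor> + m. ?f n)
        \<le> K * sqrt t * (2 powr \<sigma> * t powr (- \<sigma> + \<sigma> * \<delta>) * real m powr - \<sigma>)"
      using K t by (simp add: mult_left_mono)
    then have "real m powr - \<sigma> * norm (\<Sum>n=Suc (A m)..nat \<lfloor>t\<rfloor> + m. ?f n)
        \<le> real m powr - \<sigma> * (K * sqrt t * (2 powr \<sigma> * t powr (- \<sigma> + \<sigma> * \<delta>) * real m powr - \<sigma>))"
      by (intro mult_left_mono) auto
    also have "\<dots> = K * 2 powr \<sigma> * (t powr (1/2) * t powr (- \<sigma> + \<sigma> * \<delta>))
        * (real m powr - \<sigma> * real m powr - \<sigma>)"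
      using t by (simp add: powr_half_sqrt)
    also have "\<dots> = K * 2 powr \<sigma> * t powr (1/2 - \<sigma> + \<sigma> * \<delta>) * real m powr - (2 * \<sigma>)"
      by (simp only: powr_add[symmetric]) (simp add: algebra_simps)
    finally show ?thesis
      by (simp add: norm_mult)
  qed
  have "norm (S1 \<sigma> t \<delta>)
      \<le> (\<Sum>m=1..M. K * 2 powr \<sigma> * t powr (1/2 - \<sigma> + \<sigma> * \<delta>) * real m powr - (2 * \<sigma>))"
    unfolding S1_eq by (rule sum_norm_le) (rule summand)
  also have "\<dots> = K * 2 powr \<sigma> * t powr (1/2 - \<sigma> + \<sigma> * \<delta>) * (\<Sum>m=1..M. real m powr - (2 * \<sigma>))"
    by (simp only: sum_distrib_left)
  finally show ?thesis
    by (simp add: K_def M_def)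
qed


section \<open>The asymptotic bounds\<close>

theorem theorem5p1:
  fixes \<sigma> \<delta> :: real
  assumes "0 < \<delta>" "\<delta> < 1" "0 < \<sigma>" "\<sigma> < 1"
  shows "(\<sigma> \<noteq> 1/2 \<longrightarrow>
           (\<exists>E1 E2 :: real \<Rightarrow> complex.
              E1 \<in> O[at_top](\<lambda>t. of_real
                (t powr (1/2 - \<sigma>) * (t powr ((1 - \<sigma>) * \<delta>) + t powr (\<sigma> * \<delta>)))) \<and>
              E2 \<in> O[at_top](\<lambda>t. of_real (t powr ((1 - \<sigma>) * \<delta>) / t powr \<sigma>)) \<and>
              (\<forall>t>0. S1 \<sigma> t \<delta> = E1 t + E2 t))) \<and>
         (\<sigma> = 1/2 \<longrightarrow>
           (\<exists>E1 E2 :: real \<Rightarrow> complex.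
              E1 \<in> O[at_top](\<lambda>t. of_real (t powr (\<delta> / 2) * ln t)) \<and>
              E2 \<in> O[at_top](\<lambda>t. of_real (t powr (\<delta> / 2) / t powr (1/2))) \<and>
              (\<forall>t>0. S1 (1/2) t \<delta> = E1 t + E2 t)))"
proof -
  define C where "C = 100 * 2 powr \<sigma> / (1 - 2 powr - \<sigma>)"
  define M where "M t = nat \<lfloor>t powr \<delta>\<rfloor>" for t
  have C: "0 \<le> C"
    using assms powr_less_one[of 2 "-\<sigma>"] by (simp add: C_def)
  have S1: "norm (S1 \<sigma> t \<delta>) \<le> C * t powr (1/2 - \<sigma> + \<sigma> * \<delta>) * (\<Sum>m=1..M t. real m powr - (2 * \<sigma>))"
    if "1 \<le> t" for t
    unfolding C_def M_def using assms that by (rule norm_S1_le)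
  have M: "1 \<le> M t" "real (M t) \<le> t powr \<delta>" if "1 \<le> t" for t
    using ge_one_powr_ge_zero[of t \<delta>] assms that unfolding M_def by linarith+
  \<comment> \<open>The power of \<open>t\<close> dominates for \<open>\<sigma> < 1/2\<close>, the 1
    for \<open>\<sigma> > 1/2\<close>, where the series converges; their sum covers both cases and
    produces the two terms of the final bound.\<close>
  have sum_bound: "\<exists>B\<ge>0. \<forall>t\<ge>1. (\<Sum>m=1..M t. real m powr - (2 * \<sigma>)) \<le> B * (t powr ((1 - 2 * \<sigma>) * \<delta>) + 1)"
    if "\<sigma> \<noteq> 1/2"
  proof (cases "\<sigma> < 1/2")
    case True
    have "(\<Sum>m=1..M t. real m powr - (2 * \<sigma>)) \<le> 1 / (1 - 2 * \<sigma>) * (t powr ((1 - 2 * \<sigma>) * \<delta>) + 1)"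
      if t: "1 \<le> t" for t
    proof -
      have "(\<Sum>m=1..M t. real m powr - (2 * \<sigma>)) \<le> real (M t) powr (1 - 2 * \<sigma>) / (1 - 2 * \<sigma>)"
        using True assms by (intro sum_powr_minus_le) auto
      also have "\<dots> \<le> (t powr \<delta>) powr (1 - 2 * \<sigma>) / (1 - 2 * \<sigma>)"
        using M[OF t] True by (intro divide_right_mono powr_mono2) auto
      also have "\<dots> \<le> ((t powr \<delta>) powr (1 - 2 * \<sigma>) + 1) / (1 - 2 * \<sigma>)"
        using True by (intro divide_right_mono) auto
      finally show ?thesis
        by (simp add: powr_powr mult.commute)
    qed
    then show ?thesis
      using True by (intro exI[of _ "1 / (1 - 2 * \<sigma>)"]) auto
  next
    case False
    define B where "B = (\<Sum>m. real m powr - (2 * \<sigma>))"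
    have summable: "summable (\<lambda>m. real m powr - (2 * \<sigma>))"
      using False that by (subst summable_real_powr_iff) auto
    have B: "0 \<le> B"
      unfolding B_def by (rule suminf_nonneg[OF summable]) simp
    have "(\<Sum>m=1..M t. real m powr - (2 * \<sigma>)) \<le> B * (t powr ((1 - 2 * \<sigma>) * \<delta>) + 1)" for t
    proof -
      have "(\<Sum>m=1..M t. real m powr - (2 * \<sigma>)) \<le> B"
        unfolding B_def by (rule sum_le_suminf[OF summable]) auto
      also have "\<dots> \<le> B * (t powr ((1 - 2 * \<sigma>) * \<delta>) + 1)"
        using B by (simp add: algebra_simps)
      finally show ?thesis .
    qed
    then show ?thesis
      using B by blast
  qed
  have ne_half: "(\<lambda>t. S1 \<sigma> t \<delta>) \<in> O[at_top](\<lambda>t. of_real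
      (t powr (1/2 - \<sigma>) * (t powr ((1 - \<sigma>) * \<delta>) + t powr (\<sigma> * \<delta>))))" if "\<sigma> \<noteq> 1/2"
  proof -
    obtain B where B: "0 \<le> B"
      "\<And>t. 1 \<le> t \<Longrightarrow> (\<Sum>m=1..M t. real m powr - (2 * \<sigma>)) \<le> B * (t powr ((1 - 2 * \<sigma>) * \<delta>) + 1)"
      using sum_bound \<open>\<sigma> \<noteq> 1/2\<close> by blast
    have "norm (S1 \<sigma> t \<delta>) \<le> C * B * norm (complex_of_real
        (t powr (1/2 - \<sigma>) * (t powr ((1 - \<sigma>) * \<delta>) + t powr (\<sigma> * \<delta>))))" if t: "1 \<le> t" for t
    proof -
      have "norm (S1 \<sigma> t \<delta>)
          \<le> C * t powr (1/2 - \<sigma> + \<sigma> * \<delta>) * (B * (t powr ((1 - 2 * \<sigma>) * \<delta>) + 1))"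
        by (rule order_trans[OF S1[OF t] mult_left_mono[OF B(2)[OF t]]]) (use C in auto)
      also have "\<dots> = C * B * (t powr (1/2 - \<sigma> + \<sigma> * \<delta> + (1 - 2 * \<sigma>) * \<delta>)
          + t powr (1/2 - \<sigma> + \<sigma> * \<delta>))"
        by (simp only: powr_add distrib_left mult_1_right mult_ac)
      also have "1/2 - \<sigma> + \<sigma> * \<delta> + (1 - 2 * \<sigma>) * \<delta> = 1/2 - \<sigma> + (1 - \<sigma>) * \<delta>"
        by (simp add: algebra_simps)
      also have "t powr (1/2 - \<sigma> + (1 - \<sigma>) * \<delta>) + t powr (1/2 - \<sigma> + \<sigma> * \<delta>)
          = t powr (1/2 - \<sigma>) * (t powr ((1 - \<sigma>) * \<delta>) + t powr (\<sigma> * \<delta>))"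
        by (simp only: powr_add distrib_left)
      also have "\<dots> = norm (complex_of_real \<dots>)"
        by (simp only: norm_of_real) simp
      finally show ?thesis .
    qed
    then show ?thesis
      by (intro bigoI[of _ "C * B"] eventually_at_top_linorderI[of 1]) auto
  qed
  have half: "(\<lambda>t. S1 (1/2) t \<delta>) \<in> O[at_top](\<lambda>t. of_real (t powr (\<delta> / 2) * ln t))" if "\<sigma> = 1/2"
  proof -
    \<comment> \<open>From \<open>t \<ge> exp 1\<close> on, \<open>ln t \<ge> 1\<close> absorbs the
      constant in the harmonic bound \<open>1 + ln (M t)\<close>; this accounts for the factor
      2.\<close>
    have "norm (S1 \<sigma> t \<delta>) \<le> 2 * C * norm (complex_of_real (t powr (\<delta> / 2) * ln t))"
      if t: "exp 1 \<le> t" for t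
    proof -
      have t1: "1 \<le> t"
        using t exp_ge_add_one_self[of 1] by linarith
      have ln: "1 \<le> ln t"
        using t t1 by (simp add: ln_ge_iff)
      have "(\<Sum>m=1..M t. real m powr - (2 * \<sigma>)) = harm (M t)"
        unfolding \<open>\<sigma> = 1/2\<close> by (simp add: harm_def powr_minus)
      also have "\<dots> \<le> 1 + ln (real (M t))"
        \<comment> \<open>The decreasing sequence \<open>harm n - ln n\<close> has the value 1 at
          \<open>n = 1\<close>.\<close>
        using euler_mascheroni_sequence_decreasing[of 1 "M t"] M[OF t1] by (simp add: harm_expand)
      also have "ln (real (M t)) \<le> ln (t powr \<delta>)"
        using M[OF t1] by (subst ln_le_cancel_iff) auto
      also have "\<dots> = \<delta> * ln t"
        using t1 by (simp add: ln_powr)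
      also have "1 + \<delta> * ln t \<le> ln t + 1 * ln t"
        using ln assms by (intro add_mono mult_right_mono) auto
      finally have "(\<Sum>m=1..M t. real m powr - (2 * \<sigma>)) \<le> 2 * ln t"
        by simp
      then have "norm (S1 \<sigma> t \<delta>) \<le> C * t powr (1/2 - \<sigma> + \<sigma> * \<delta>) * (2 * ln t)"
        using C by (intro order_trans[OF S1[OF t1]] mult_left_mono) auto
      then show ?thesis
        using ln unfolding \<open>\<sigma> = 1/2\<close> by (simp add: norm_mult mult_ac)
    qed
    then show ?thesis
      using that
      by (intro bigoI[of _ "2 * C"] eventually_at_top_linorderI[of "exp 1"]) auto
  qed
  show ?thesis
  proof (intro conjI impI)
    assume "\<sigma> \<noteq> 1/2"
    from ne_half[OF this] show "\<exists>E1 E2 :: real \<Rightarrow> complex.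
              E1 \<in> O[at_top](\<lambda>t. of_real
                (t powr (1/2 - \<sigma>) * (t powr ((1 - \<sigma>) * \<delta>) + t powr (\<sigma> * \<delta>)))) \<and>
              E2 \<in> O[at_top](\<lambda>t. of_real (t powr ((1 - \<sigma>) * \<delta>) / t powr \<sigma>)) \<and>
              (\<forall>t>0. S1 \<sigma> t \<delta> = E1 t + E2 t)"
      by (intro exI[of _ "\<lambda>t. S1 \<sigma> t \<delta>"] exI[of _ "\<lambda>_. 0"]) simp
  next
    assume "\<sigma> = 1/2"
    from half[OF this] show "\<exists>E1 E2 :: real \<Rightarrow> complex.
              E1 \<in> O[at_top](\<lambda>t. of_real (t powr (\<delta> / 2) * ln t)) \<and>
              E2 \<in> O[at_top](\<lambda>t. of_real (t powr (\<delta> / 2) / t powr (1/2))) \<and>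
              (\<forall>t>0. S1 (1/2) t \<delta> = E1 t + E2 t)"
      by (intro exI[of _ "\<lambda>t. S1 (1/2) t \<delta>"] exI[of _ "\<lambda>_. 0"]) simp
  qed
qed

end
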